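(* Let $p>5$ be a prime. Then $$\sum_{k=0}^{p-1} k\cdot \frac{\left(\frac{1}{p+1}\right)_k^{\,p+1}}{(k!)^{p+1}} \equiv \frac{p^3}{4}-\frac{p^4}{8}+\frac{3}{16}p^5-\frac{1}{36}p^5B_{p-3} \pmod{p^6}.$$
   Context: $(x)_k=x(x+1)\cdots(x+k-1)$ denotes the Pochhammer symbol (with $(x)_0=1$), and $B_0,B_1,B_2,\dots$ are the Bernoulli numbers. Congruences between rational numbers are understood in the ring of rationals whose denominators are prime to $p$. *)

theory Defs
  imports Complex_Main "HOL-Computational_Algebra.Primes"
begin

text \<open>
  The recursion solves \<open>(\<Sum>k\<le>m. ((m + 1) choose k) * B\<^sub>k) = 0\<close> for \<open>m \<ge> 1\<close>,
  starting from \<open>B\<^sub>0 = 1\<close>; thus \<open>B\<^sub>n / n!\<close> are the coefficients of \<open>t / (exp t - 1)\<close>,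
  with the convention \<open>B\<^sub>1 = -1/2\<close>.
\<close>

fun bernoulli :: "nat \<Rightarrow> rat" where
  "bernoulli 0 = 1"
| "bernoulli (Suc n) =
     - (\<Sum>k\<le>n. of_nat ((n + 2) choose k) * bernoulli k) / of_nat (n + 2)"

text \<open>
  Since \<^const>\<open>quotient_of\<close> returns numerator and positive denominator in lowest terms,
  this is the ring of rationals with denominator prime to \<open>p\<close>.
\<close>

definition p_integers :: "nat \<Rightarrow> rat set" where
  "p_integers p = {x. coprime (snd (quotient_of x)) (int p)}"

text \<open>
  Congruence in that ring. Membership of both sides is part of the relation, and the
  multiplier \<open>z\<close> must lie in the ring: the library's \<open>cong\<close> is trivial on a field.
\<close>

definition p_cong :: "nat \<Rightarrow> rat \<Rightarrow> rat \<Rightarrow> rat \<Rightarrow> bool" where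
  "p_cong p x y m \<longleftrightarrow>
     x \<in> p_integers p \<and> y \<in> p_integers p \<and> (\<exists>z\<in>p_integers p. x - y = m * z)"

end

theory Submission
  imports Defs "HOL-Number_Theory.Residues"
begin

text \<open>
  Put \<open>t = p / (p + 1)\<close>. The \<open>k\<close>-th summand is \<open>k\<close> times the product of
  \<open>(1 - t / j) ^ (p + 1)\<close> over \<open>1 \<le> j \<le> k\<close>, and each factor agrees modulo \<open>p ^ 6\<close> with
  \<open>(1 - p / j) (1 + d\<^sub>2 / j ^ 2 + d\<^sub>3 / j ^ 3 + d\<^sub>4 / j ^ 4)\<close>, where \<open>d\<^sub>i\<close> is divisible by \<open>p ^ (i + 1)\<close>.
  As \<open>p ^ 3\<close> divides every \<open>d\<^sub>i\<close>, the corrections simply add up, and with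
  \<open>w\<^sub>k = (-1) ^ k ((p - 1) choose k)\<close> the sum becomes
  \<open>\<Sum> k w\<^sub>k (1 + d\<^sub>2 H\<^sub>k(2) + d\<^sub>3 H\<^sub>k(3) + d\<^sub>4 H\<^sub>k(4))\<close>, \<open>H\<^sub>k(r)\<close> being the generalised harmonic numbers.
  Since \<open>k w\<^sub>k\<close> telescopes, the leading sum vanishes and summation by parts turns the others into
  alternating binomial sums. With \<open>H(r) = H\<^sub>p\<^sub>-\<^sub>1(r)\<close>, those at \<open>d\<^sub>2\<close> and \<open>d\<^sub>3\<close> are polynomials in
  \<open>H(1)\<close> and \<open>H(2)\<close>; the one at \<open>d\<^sub>4\<close> only matters modulo \<open>p\<close>, where it vanishes.

  It remains to know \<open>H(1)\<close> modulo \<open>p ^ 3\<close> and \<open>H(2)\<close> modulo \<open>p ^ 2\<close>. Pairing \<open>j\<close> with \<open>p - j\<close> gives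
  \<open>2 H(1) \<equiv> - p H(2)\<close>. Comparing \<open>\<Sum> w\<^sub>i / i ^ 2 = - (H(1) ^ 2 + H(2)) / 2\<close> with
  \<open>w\<^sub>i \<equiv> 1 - p H\<^sub>i(1)\<close> gives \<open>3 H(2) \<equiv> 2 p \<Sum> H\<^sub>i(1) / i ^ 2\<close>, and the last sum is
  \<open>B\<^sub>p\<^sub>-\<^sub>3\<close> modulo \<open>p\<close> by Faulhaber's formula, because \<open>1 / a \<equiv> a ^ (p - 2)\<close>.
  This route avoids Kummer's congruences.
\<close>

section \<open>Bernoulli numbers and alternating binomial sums\<close>

lemma bernoulli_sum_eq_0:
  assumes "n > 0"
  shows "(\<Sum>k\<le>n. of_nat (Suc n choose k) * bernoulli k) = 0"
proof -
  obtain m where m: "n = Suc m" using assms not0_implies_Suc by blast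
  define S where "S = (\<Sum>k\<le>m. of_nat ((m + 2) choose k) * bernoulli k)"
  have "Suc (Suc m) choose Suc m = m + 2" using binomial_Suc_n[of "Suc m"] by simp
  then have "(\<Sum>k\<le>n. of_nat (Suc n choose k) * bernoulli k)
      = S + of_nat (m + 2) * (- S / of_nat (m + 2))"
    by (simp add: m S_def del: binomial_Suc_Suc)
  also have "\<dots> = 0" by (simp add: field_simps)
  finally show ?thesis .
qed

text \<open>Induction on \<open>j\<close>: the binomial theorem expands the increment of the right
  side, and the coefficient of each \<open>x ^ r\<close> then contains the Bernoulli recurrence for
  \<open>m - r\<close>. The strict bound \<open>i < j\<close> belongs to the convention with value
  \<open>-1/2\<close> at index 1.\<close>

lemma faulhaber:
  "of_nat (Suc m) * (\<Sum>i<j. of_nat i ^ m)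
    = (\<Sum>l\<le>m. of_nat (Suc m choose l) * bernoulli l * of_nat j ^ (Suc m - l))"
proof (induction j)
  case 0
  then show ?case by (auto simp: power_0_left intro!: sum.neutral[symmetric])
next
  case (Suc j)
  define x where "x = (of_nat j :: rat)"
  have diff: "(x + 1) ^ N - x ^ N = (\<Sum>r<N. of_nat (N choose r) * x ^ r)" for N
    by (simp add: binomial_ring lessThan_Suc_atMost[symmetric])
  \<comment> \<open>Both products are the multinomial coefficient with parts \<open>l\<close>,
    \<open>r\<close> and \<open>Suc m - l - r\<close>.\<close>
  have choose: "of_nat (Suc m choose l) * of_nat (Suc m - l choose r)
      = (of_nat (Suc m choose r) * of_nat (Suc m - r choose l) :: rat)" if "l + r \<le> m" for l r
  proof -
    have "(Suc m choose l) * (Suc m - l choose r) = (Suc m choose r) * (Suc m - r choose l)"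
      using choose_mult[of l "l + r" "Suc m"] choose_mult[of r "l + r" "Suc m"] that
        binomial_symmetric[of l "l + r"] by simp
    then show ?thesis by (metis of_nat_mult)
  qed
  have "(\<Sum>l\<le>m. of_nat (Suc m choose l) * bernoulli l * ((x + 1) ^ (Suc m - l) - x ^ (Suc m - l)))
     = (\<Sum>l\<le>m. \<Sum>r | r \<in> {..m} \<and> l + r \<le> m.
          of_nat (Suc m choose r) * x ^ r * (of_nat (Suc m - r choose l) * bernoulli l))"
    unfolding diff sum_distrib_left
    by (intro sum.cong refl) (use choose in \<open>auto simp: mult_ac\<close>)
  also have "\<dots> = (\<Sum>r\<le>m. \<Sum>l | l \<in> {..m} \<and> l + r \<le> m.
          of_nat (Suc m choose r) * x ^ r * (of_nat (Suc m - r choose l) * bernoulli l))"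
    by (rule sum.swap_restrict) auto
  also have "\<dots> = (\<Sum>r\<le>m. of_nat (Suc m choose r) * x ^ r *
          (\<Sum>l\<le>m - r. of_nat (Suc (m - r) choose l) * bernoulli l))"
    unfolding sum_distrib_left
    by (intro sum.cong refl) (auto simp: Suc_diff_le)
  \<comment> \<open>For \<open>r < m\<close> the inner sum vanishes by the recurrence; for
    \<open>r = m\<close> it is 1.\<close>
  also have "\<dots> = (\<Sum>r\<le>m. if r = m then of_nat (Suc m) * x ^ m else 0)"
    by (intro sum.cong refl) (auto simp: bernoulli_sum_eq_0 simp del: binomial_Suc_Suc)
  also have "\<dots> = of_nat (Suc m) * x ^ m" by simp
  finally show ?case using Suc
    by (simp add: x_def algebra_simps sum_subtractf del: binomial_Suc_Suc)
qed

section \<open>Alternating binomial sums and harmonic numbers\<close>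

definition alt_binomial_sum :: "nat \<Rightarrow> nat \<Rightarrow> rat" where
  "alt_binomial_sum r n = (\<Sum>i=1..n. - ((-1) ^ i * of_nat (n choose i) / of_nat i ^ r))"

text \<open>The alternating sum of row \<open>n\<close> vanishes, and its omitted term at
  \<open>i = 0\<close> is 1.\<close>

lemma alt_binomial_sum_0: "n > 0 \<Longrightarrow> alt_binomial_sum 0 n = 1"
proof -
  assume "n > 0"
  have "(\<Sum>i\<le>n. (-1) ^ i * of_nat (n choose i)) = (1 - alt_binomial_sum 0 n)"
    by (simp add: alt_binomial_sum_def sum_negf sum.atMost_shift atMost_atLeast0 sum.atLeast_Suc_atMost)
  then show ?thesis using choose_alternating_sum[OF \<open>n > 0\<close>, where ?'a = rat] by simp
qed

text \<open>Pascal's rule splits \<open>Suc n choose i\<close>; absorption turns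
  \<open>n choose (i - 1)\<close> into \<open>i / Suc n\<close> times \<open>Suc n choose i\<close>,
  and this factor \<open>i\<close> lowers the exponent by one.\<close>

lemma alt_binomial_sum_Suc:
  "alt_binomial_sum (Suc r) (Suc n)
    = alt_binomial_sum (Suc r) n + alt_binomial_sum r (Suc n) / of_nat (Suc n)"
proof -
  have "- ((-1) ^ i * of_nat (Suc n choose i) / of_nat i ^ Suc r)
      = - ((-1) ^ i * of_nat (n choose i) / of_nat i ^ Suc r)
        + - ((-1) ^ i * of_nat (Suc n choose i) / of_nat i ^ r) / (of_nat (Suc n) :: rat)"
    if i: "i \<in> {1..Suc n}" for i
  proof -
    obtain k where k: "i = Suc k" using i by (cases i) auto
    have "of_nat (Suc k) * of_nat (Suc n choose Suc k) = (of_nat (Suc n) * of_nat (n choose k) :: rat)"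
      by (metis Suc_times_binomial of_nat_mult)
    then have "of_nat (n choose k) = (of_nat (Suc k) * of_nat (Suc n choose Suc k) / of_nat (Suc n) :: rat)"
      by (simp add: field_simps del: binomial_Suc_Suc)
    then have "of_nat (Suc n choose i)
        = (of_nat (n choose i) + of_nat i * of_nat (Suc n choose i) / of_nat (Suc n) :: rat)"
      unfolding k by (metis add.commute binomial_Suc_Suc of_nat_add)
    then have "(-1) ^ i * of_nat (Suc n choose i) / of_nat i ^ Suc r
      = (-1) ^ i * (of_nat (n choose i) + of_nat i * of_nat (Suc n choose i) / of_nat (Suc n)) / (of_nat i ^ Suc r :: rat)"
      by simp
    also have "\<dots> = (-1) ^ i * of_nat (n choose i) / of_nat i ^ Suc r
       + (-1) ^ i * of_nat (Suc n choose i) / of_nat i ^ r / of_nat (Suc n)"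
      using k by (simp add: field_simps del: binomial_Suc_Suc of_nat_Suc)
    finally show ?thesis by (simp del: binomial_Suc_Suc)
  qed
  then have "alt_binomial_sum (Suc r) (Suc n)
     = (\<Sum>i=1..Suc n. - ((-1) ^ i * of_nat (n choose i) / of_nat i ^ Suc r)
        + - ((-1) ^ i * of_nat (Suc n choose i) / of_nat i ^ r) / (of_nat (Suc n) :: rat))"
    unfolding alt_binomial_sum_def by (rule sum.cong[OF refl])
  also have "\<dots> = (\<Sum>i=1..Suc n. - ((-1) ^ i * of_nat (n choose i) / of_nat i ^ Suc r))
       + alt_binomial_sum r (Suc n) / of_nat (Suc n)"
    by (simp only: sum.distrib sum_divide_distrib alt_binomial_sum_def)
  also have "(\<Sum>i=1..Suc n. - ((-1) ^ i * of_nat (n choose i) / of_nat i ^ Suc r))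
      = alt_binomial_sum (Suc r) n"
    by (simp add: alt_binomial_sum_def)
  finally show ?thesis .
qed

definition harm_pow :: "nat \<Rightarrow> nat \<Rightarrow> rat" where
  "harm_pow r n = (\<Sum>j=1..n. 1 / of_nat j ^ r)"

lemma harm_pow_0 [simp]: "harm_pow r 0 = 0"
  by (simp add: harm_pow_def)

lemma harm_pow_Suc: "harm_pow r (Suc n) = harm_pow r n + 1 / of_nat (Suc n) ^ r"
  by (simp add: harm_pow_def)

lemma alt_binomial_sum_1: "alt_binomial_sum 1 n = harm_pow 1 n"
  by (induction n)
     (simp_all add: alt_binomial_sum_Suc alt_binomial_sum_0 harm_pow_Suc, simp add: alt_binomial_sum_def)

text \<open>With \<open>x = 1 / (n + 1)\<close> and \<open>H = harm_pow 1 n\<close>, the right side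
  grows by \<open>((H + x)^2 - H^2 + x^2) / 2 = x (H + x)\<close>, which is the increment in the
  recursion.\<close>

lemma alt_binomial_sum_2: "alt_binomial_sum 2 n = (harm_pow 1 n ^ 2 + harm_pow 2 n) / 2"
proof (induction n)
  case (Suc n)
  have "alt_binomial_sum 2 (Suc n) = alt_binomial_sum 2 n + harm_pow 1 (Suc n) / of_nat (Suc n)"
    using alt_binomial_sum_Suc[of 1 n] by (simp only: alt_binomial_sum_1 Suc_1)
  then show ?case unfolding Suc harm_pow_Suc
    by (simp add: power2_eq_square add_divide_distrib distrib_left distrib_right del: of_nat_Suc)
qed (simp add: alt_binomial_sum_def)

section \<open>The weights and summation by parts\<close>

text \<open>The product form matches the leading factors \<open>1 - p / j\<close> of the summand and
  shows that the weight vanishes at \<open>k = p\<close> for positive \<open>p\<close>.\<close>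

definition binomial_weight :: "nat \<Rightarrow> nat \<Rightarrow> rat" where
  "binomial_weight p k = (\<Prod>j=1..k. 1 - of_nat p / of_nat j)"

lemma binomial_weight_0 [simp]: "binomial_weight p 0 = 1"
  by (simp add: binomial_weight_def)

lemma binomial_weight_Suc:
  "binomial_weight p (Suc k) = binomial_weight p k * (1 - of_nat p / of_nat (Suc k))"
  by (simp add: binomial_weight_def)

lemma binomial_weight_eq:
  assumes "p > 0"
  shows "binomial_weight p k = (-1) ^ k * of_nat (p - 1 choose k)"
proof (induction k)
  case (Suc k)
  have "of_nat (Suc k) * of_nat (p - 1 choose Suc k) = (of_nat (p - 1 - k) * of_nat (p - 1 choose k) :: rat)"
    by (metis binomial_absorption binomial_absorb_comp of_nat_mult)
  also have "\<dots> = (of_nat p - of_nat (Suc k)) * of_nat (p - 1 choose k)"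
    \<comment> \<open>Beyond \<open>p - 1\<close> the subtraction is truncated, but the binomial
      coefficient is 0.\<close>
    using assms by (cases "k \<le> p - 1") (auto simp: of_nat_diff)
  finally have "of_nat (p - 1 choose Suc k)
      = - ((1 - of_nat p / of_nat (Suc k)) * of_nat (p - 1 choose k) :: rat)"
    by (simp add: field_simps del: of_nat_Suc)
  then show ?case unfolding binomial_weight_Suc Suc by simp
qed simp

lemma sum_binomial_weight:
  assumes "p > 0"
  shows "(\<Sum>i=1..p-1. binomial_weight p i / of_nat i ^ r) = - alt_binomial_sum r (p - 1)"
  by (simp add: alt_binomial_sum_def binomial_weight_eq[OF assms] sum_negf)

lemma summation_by_parts:
  fixes g h :: "nat \<Rightarrow> 'a :: comm_ring_1"
  shows "(\<Sum>k<n. (g k - g (Suc k)) * h k)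
    = g 0 * h 0 - g n * h n + (\<Sum>k<n. g (Suc k) * (h (Suc k) - h k))"
  by (induction n) (simp_all add: algebra_simps)

text \<open>Since \<open>(k + 1) w(k + 1) = (k + 1 - p) w(k)\<close>, the function
  \<open>g k = k (k - 1) w(k) / (p - 2)\<close> satisfies \<open>g k - g (k + 1) = k w(k)\<close>.
  It is zero at 0 and at \<open>p\<close>, so summation by parts leaves no boundary terms.\<close>

lemma sum_binomial_weight_mult:
  fixes h :: "nat \<Rightarrow> rat"
  assumes "p > 2"
  shows "(\<Sum>k=0..p-1. of_nat k * binomial_weight p k * h k)
    = (\<Sum>i=1..p-1. of_nat i * (of_nat i - 1) * binomial_weight p i * (h i - h (i - 1))) / (of_nat p - 2)"
proof -
  define g where "g = (\<lambda>k. of_nat k * (of_nat k - 1) * binomial_weight p k / (of_nat p - 2))"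
  have p2: "(of_nat p - 2 :: rat) \<noteq> 0"
    using assms by (metis eq_iff_diff_eq_0 nat_neq_iff of_nat_eq_iff of_nat_numeral)
  have g: "g k - g (Suc k) = of_nat k * binomial_weight p k" for k
  proof -
    define w where "w = binomial_weight p k"
    have "g (Suc k) = (of_nat (Suc k) * (1 - of_nat p / of_nat (Suc k))) * of_nat k * w / (of_nat p - 2)"
      by (simp add: g_def binomial_weight_Suc w_def)
    also have "of_nat (Suc k) * (1 - of_nat p / of_nat (Suc k)) = (of_nat k + 1 - of_nat p :: rat)"
      by (simp add: field_simps)
    finally have gS: "g (Suc k) = (of_nat k + 1 - of_nat p) * of_nat k * w / (of_nat p - 2)" .
    have "g k - g (Suc k) = of_nat k * w * (of_nat p - 2) / (of_nat p - 2)"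
      unfolding gS by (simp add: g_def w_def diff_divide_distrib[symmetric] algebra_simps)
    then show ?thesis using p2 by (simp add: w_def)
  qed
  have "binomial_weight p p = 0" using assms
    unfolding binomial_weight_def by (intro prod_zero bexI[of _ p]) auto
  then have g0: "g 0 = 0" "g p = 0" by (simp_all add: g_def)
  have lessThan: "{0..p-1} = {..<p}" using assms by auto
  have "(\<Sum>k=0..p-1. of_nat k * binomial_weight p k * h k) = (\<Sum>k<p. g (Suc k) * (h (Suc k) - h k))"
    unfolding lessThan g[symmetric] summation_by_parts g0 by simp
  \<comment> \<open>The dropped term \<open>k = p - 1\<close> carries the factor
    \<open>g p = 0\<close>.\<close>
  also have "\<dots> = (\<Sum>k<p-1. g (Suc k) * (h (Suc k) - h k))"
  proof (intro sum.mono_neutral_right ballI)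
    fix k assume "k \<in> {..<p} - {..<p-1}"
    then have "Suc k = p" by auto
    then show "g (Suc k) * (h (Suc k) - h k) = 0" using g0 by simp
  qed auto
  also have "\<dots> = (\<Sum>i=1..p-1. g i * (h i - h (i - 1)))"
    by (rule sum.reindex_bij_witness[of _ "\<lambda>i. i - 1" Suc]) auto
  finally show ?thesis by (simp add: g_def sum_divide_distrib)
qed

text \<open>The increment of the harmonic number at \<open>i\<close> is
  \<open>1 / i ^ (r + 2)\<close>, and multiplying it by \<open>i (i - 1)\<close> gives
  \<open>1 / i ^ r - 1 / i ^ (r + 1)\<close>.\<close>

lemma sum_binomial_weight_harm_pow:
  assumes "p > 2"
  shows "(\<Sum>k=0..p-1. of_nat k * binomial_weight p k * harm_pow (Suc (Suc r)) k)
    = (\<Sum>i=1..p-1. binomial_weight p i / of_nat i ^ r - binomial_weight p i / of_nat i ^ Suc r)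
      / (of_nat p - 2)"
  unfolding sum_binomial_weight_mult[OF assms]
proof (intro arg_cong2[where f = "(/)"] sum.cong refl)
  fix i assume "i \<in> {1..p-1}"
  then obtain k where k: "i = Suc k" by (cases i) auto
  have "of_nat i \<noteq> (0 :: rat)" using k by simp
  then show "of_nat i * (of_nat i - 1) * binomial_weight p i
      * (harm_pow (Suc (Suc r)) i - harm_pow (Suc (Suc r)) (i - 1))
    = binomial_weight p i / of_nat i ^ r - binomial_weight p i / of_nat i ^ Suc r"
    unfolding k harm_pow_Suc by (simp add: field_simps del: of_nat_Suc)
qed

text \<open>Geometric expansions of powers of \<open>v = 1 / (P + 1)\<close> up to
  \<open>P ^ 6\<close>, with exact remainders so that their integrality can be checked. The left
  sides are, up to constants, the terms of degree 2, 3 and 4 in the expansion of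
  \<open>(1 - P v y) ^ (p + 1)\<close>, after one factor \<open>(P + 1) v\<close> has been
  cancelled.\<close>

lemma inverse_successor_expansions:
  fixes P v :: rat
  assumes "(P + 1) * v = 1"
  shows "P ^ 3 * v = P ^ 3 - P ^ 4 + P ^ 5 - P ^ 6 * v"
    and "(P - 1) * P ^ 4 * v ^ 2
      = - (P ^ 4) + 3 * P ^ 5 - P ^ 6 * (2 - (P - 1) * (2 * v + v ^ 2))"
    and "(P - 1) * (P - 2) * P ^ 5 * v ^ 3
      = 2 * P ^ 5 + P ^ 6 * (P - 3 - (P - 1) * (P - 2) * (v + v ^ 2 + v ^ 3))"
proof -
  have step: "P ^ n * v = P ^ n - P ^ Suc n * v" for n
    using arg_cong[OF assms, of "\<lambda>x. P ^ n * x"] by (simp add: algebra_simps)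
  show "P ^ 3 * v = P ^ 3 - P ^ 4 + P ^ 5 - P ^ 6 * v"
    using step[of 3] step[of 4] step[of 5] by simp
  have "P * v = 1 - v" using assms by (simp add: algebra_simps)
  then have Pv: "P * v ^ Suc n = v ^ n - v ^ Suc n" for n
    by (simp add: left_diff_distrib flip: mult.assoc)
  define r where "r = 2 * v + v ^ 2"
  have "P ^ 2 * r = P * (2 * (P * v ^ Suc 0) + P * v ^ Suc 1)"
    by (simp add: r_def algebra_simps power2_eq_square)
  also have "\<dots> = P * (2 * (1 - v) + (v - v ^ 2))"
    unfolding Pv by (simp add: power2_eq_square)
  also have "\<dots> = 2 * P - P * v ^ Suc 0 - P * v ^ Suc 1"
    by (simp add: algebra_simps power2_eq_square)
  also have "\<dots> = 2 * P - 1 + v ^ 2"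
    unfolding Pv by (simp add: power2_eq_square)
  finally have "v ^ 2 = 1 - 2 * P + P ^ 2 * r" by simp
  then have "(P - 1) * P ^ 4 * v ^ 2 = (P - 1) * P ^ 4 * (1 - 2 * P + P ^ 2 * r)"
    by (simp only:)
  also have "\<dots> = - (P ^ 4) + 3 * P ^ 5 - P ^ 6 * (2 - (P - 1) * r)"
    by (simp add: algebra_simps eval_nat_numeral)
  finally show "(P - 1) * P ^ 4 * v ^ 2
      = - (P ^ 4) + 3 * P ^ 5 - P ^ 6 * (2 - (P - 1) * (2 * v + v ^ 2))"
    by (simp only: r_def)
  \<comment> \<open>From \<open>1 - v = P v\<close> follows
    \<open>1 - v ^ 3 = (1 - v) (1 + v + v ^ 2) = P q\<close>.\<close>
  define q where "q = v + v ^ 2 + v ^ 3"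
  have "P * q = P * v ^ Suc 0 + P * v ^ Suc 1 + P * v ^ Suc 2"
    by (simp add: q_def distrib_left eval_nat_numeral)
  also have "\<dots> = 1 - v ^ 3"
    by (simp only: Pv) (simp add: eval_nat_numeral)
  finally have "v ^ 3 = 1 - P * q" by simp
  then have "(P - 1) * (P - 2) * P ^ 5 * v ^ 3 = (P - 1) * (P - 2) * P ^ 5 * (1 - P * q)"
    by (simp only:)
  also have "\<dots> = 2 * P ^ 5 + P ^ 6 * (P - 3 - (P - 1) * (P - 2) * q)"
    by (simp add: algebra_simps eval_nat_numeral)
  finally show "(P - 1) * (P - 2) * P ^ 5 * v ^ 3
      = 2 * P ^ 5 + P ^ 6 * (P - 3 - (P - 1) * (P - 2) * (v + v ^ 2 + v ^ 3))"
    by (simp only: q_def)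
qed

section \<open>The ring of \<open>p\<close>-integral rationals\<close>

text \<open>The denominator in lowest terms divides every other denominator, so any fraction with
  denominator prime to \<open>p\<close> will do. This frees the closure proofs from
  \<open>quotient_of\<close>.\<close>

lemma p_integers_iff:
  assumes "prime p"
  shows "x \<in> p_integers p \<longleftrightarrow> (\<exists>a b. \<not> int p dvd b \<and> x = of_int a / of_int b)"
proof
  assume x: "x \<in> p_integers p"
  obtain a b where ab: "quotient_of x = (a, b)" by fastforce
  have "coprime b (int p)" using x ab by (simp add: p_integers_def)
  moreover have "\<not> is_unit (int p)" using assms by (simp add: prime_nat_iff)
  ultimately have "\<not> int p dvd b" by (meson coprime_common_divisor dvd_refl)
  then show "\<exists>a b. \<not> int p dvd b \<and> x = of_int a / of_int b"
    using quotient_of_div[OF ab] by blast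
next
  assume "\<exists>a b. \<not> int p dvd b \<and> x = of_int a / of_int b"
  then obtain a b where nd: "\<not> int p dvd b" and x: "x = of_int a / of_int b" by blast
  obtain c d where cd: "quotient_of x = (c, d)" by fastforce
  have "b \<noteq> 0" using nd by auto
  have "d > 0" using quotient_of_denom_pos[OF cd] .
  have "(of_int (a * d) :: rat) = of_int (c * b)"
    using quotient_of_div[OF cd] x \<open>b \<noteq> 0\<close> \<open>d > 0\<close> by (simp add: field_simps)
  then have "a * d = c * b" by (simp only: of_int_eq_iff)
  then have "d dvd c * b" by (metis dvd_triv_right)
  moreover have "coprime d c" using quotient_of_coprime[OF cd] by (simp add: coprime_commute)
  ultimately have "d dvd b" by (simp add: coprime_dvd_mult_right_iff)
  then have "\<not> int p dvd d" using nd dvd_trans by blast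
  then have "coprime d (int p)"
    using assms prime_imp_coprime[of "int p" d] by (simp add: coprime_commute)
  then show "x \<in> p_integers p" by (simp add: p_integers_def cd)
qed

text \<open>The ideal generated by \<open>p ^ n\<close>. Congruences are handled as membership of
  differences, so that closure rules do the arithmetic.\<close>

definition p_ideal :: "nat \<Rightarrow> nat \<Rightarrow> rat set" where
  "p_ideal p n = (\<lambda>z. of_nat p ^ n * z) ` p_integers p"

lemma p_ideal_0: "p_ideal p 0 = p_integers p"
  by (simp add: p_ideal_def)

context
  fixes p :: nat
  assumes prime_p: "prime p"
begin

lemma p_integers_of_int [simp, intro]: "of_int a \<in> p_integers p"
  using p_integers_iff[OF prime_p] prime_gt_1_nat[OF prime_p]
  by (metis div_by_1 of_int_1 of_nat_1 of_nat_dvd_iff less_irrefl nat_dvd_1_iff_1)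

lemma p_integers_of_nat [simp, intro]: "of_nat a \<in> p_integers p"
  by (metis of_int_of_nat_eq p_integers_of_int)

lemma p_integers_consts [simp, intro]:
  "0 \<in> p_integers p" "1 \<in> p_integers p" "numeral k \<in> p_integers p"
  by (metis of_nat_0 p_integers_of_nat, metis of_nat_1 p_integers_of_nat,
      metis of_nat_numeral p_integers_of_nat)

lemma p_integers_add [intro]:
  assumes "x \<in> p_integers p" "y \<in> p_integers p"
  shows "x + y \<in> p_integers p"
proof -
  obtain a b c d where *: "\<not> int p dvd b" "x = of_int a / of_int b"
      "\<not> int p dvd d" "y = of_int c / of_int d"
    using assms p_integers_iff[OF prime_p] by metis
  have "\<not> int p dvd b * d" using * prime_p by (simp add: prime_dvd_mult_iff)
  moreover have "x + y = of_int (a * d + c * b) / of_int (b * d)"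
    using * by (cases "b = 0 \<or> d = 0") (auto simp: field_simps)
  ultimately show ?thesis using p_integers_iff[OF prime_p] by blast
qed

lemma p_integers_mult [intro]:
  assumes "x \<in> p_integers p" "y \<in> p_integers p"
  shows "x * y \<in> p_integers p"
proof -
  obtain a b c d where *: "\<not> int p dvd b" "x = of_int a / of_int b"
      "\<not> int p dvd d" "y = of_int c / of_int d"
    using assms p_integers_iff[OF prime_p] by metis
  have "\<not> int p dvd b * d" using * prime_p by (simp add: prime_dvd_mult_iff)
  moreover have "x * y = of_int (a * c) / of_int (b * d)"
    using * by simp
  ultimately show ?thesis using p_integers_iff[OF prime_p] by blast
qed

lemma p_integers_uminus [intro]: "x \<in> p_integers p \<Longrightarrow> - x \<in> p_integers p"
  using p_integers_mult[of "-1" x] p_integers_of_int[of "-1"] by simp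

lemma p_integers_diff [intro]:
  "x \<in> p_integers p \<Longrightarrow> y \<in> p_integers p \<Longrightarrow> x - y \<in> p_integers p"
  using p_integers_add[of x "- y"] p_integers_uminus[of y] by simp

lemma p_integers_power [intro]: "x \<in> p_integers p \<Longrightarrow> x ^ n \<in> p_integers p"
  by (induction n) auto

lemma p_integers_sum [intro]:
  "(\<And>i. i \<in> A \<Longrightarrow> f i \<in> p_integers p) \<Longrightarrow> sum f A \<in> p_integers p"
  by (induction A rule: infinite_finite_induct) auto

lemma p_integers_divide_of_int:
  assumes "x \<in> p_integers p" "\<not> int p dvd b"
  shows "x / of_int b \<in> p_integers p"
proof -
  have "(of_int 1 :: rat) / of_int b \<in> p_integers p"
    using assms(2) p_integers_iff[OF prime_p] by blast
  with assms(1) have "x * (of_int 1 / of_int b) \<in> p_integers p" by blast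
  then show ?thesis by simp
qed

lemma p_integers_divide_of_nat:
  assumes "x \<in> p_integers p" "0 < k" "k < p"
  shows "x / of_nat k \<in> p_integers p"
  using p_integers_divide_of_int[of x "int k"] assms by (simp add: nat_dvd_not_less)

lemma p_ideal_iff: "x \<in> p_ideal p n \<longleftrightarrow> (\<exists>z\<in>p_integers p. x = of_nat p ^ n * z)"
  by (auto simp: p_ideal_def)

lemma p_ideal_0_mem [simp, intro]: "0 \<in> p_ideal p n"
  by (auto simp: p_ideal_iff)

lemma p_ideal_add [intro]: "x \<in> p_ideal p n \<Longrightarrow> y \<in> p_ideal p n \<Longrightarrow> x + y \<in> p_ideal p n"
  unfolding p_ideal_iff by (metis distrib_left p_integers_add)

lemma p_ideal_uminus [intro]: "x \<in> p_ideal p n \<Longrightarrow> - x \<in> p_ideal p n"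
  unfolding p_ideal_iff by (metis mult_minus_right p_integers_uminus)

lemma p_ideal_diff [intro]: "x \<in> p_ideal p n \<Longrightarrow> y \<in> p_ideal p n \<Longrightarrow> x - y \<in> p_ideal p n"
  unfolding p_ideal_iff by (metis right_diff_distrib p_integers_diff)

lemma p_ideal_sum [intro]: "(\<And>i. i \<in> A \<Longrightarrow> f i \<in> p_ideal p n) \<Longrightarrow> sum f A \<in> p_ideal p n"
  by (induction A rule: infinite_finite_induct) auto

lemma p_ideal_mult:
  assumes "x \<in> p_ideal p m" "y \<in> p_ideal p n"
  shows "x * y \<in> p_ideal p (m + n)"
proof -
  obtain u v where "u \<in> p_integers p" "v \<in> p_integers p"
      "x = of_nat p ^ m * u" "y = of_nat p ^ n * v"
    using assms by (auto simp: p_ideal_iff)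
  then have "x * y = of_nat p ^ (m + n) * (u * v)" "u * v \<in> p_integers p"
    by (auto simp: power_add algebra_simps)
  then show ?thesis unfolding p_ideal_iff by blast
qed

lemma p_ideal_mult_left [intro]: "x \<in> p_integers p \<Longrightarrow> y \<in> p_ideal p n \<Longrightarrow> x * y \<in> p_ideal p n"
  using p_ideal_mult[of x 0 y n] by (simp add: p_ideal_0)

lemma p_ideal_mult_right [intro]: "x \<in> p_ideal p n \<Longrightarrow> y \<in> p_integers p \<Longrightarrow> x * y \<in> p_ideal p n"
  using p_ideal_mult[of x n y 0] by (simp add: p_ideal_0)

lemma p_ideal_power: "x \<in> p_ideal p m \<Longrightarrow> x ^ n \<in> p_ideal p (m * n)"
  by (induction n) (auto simp: p_ideal_0 intro: p_ideal_mult)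

lemma p_ideal_prime_power_mult [intro]: "z \<in> p_integers p \<Longrightarrow> of_nat p ^ n * z \<in> p_ideal p n"
  by (auto simp: p_ideal_def)

lemma p_ideal_antimono:
  assumes "x \<in> p_ideal p n" "m \<le> n"
  shows "x \<in> p_ideal p m"
proof -
  have "of_nat p ^ (n - m) * 1 \<in> p_ideal p (n - m)" by blast
  obtain z where z: "z \<in> p_integers p" "x = of_nat p ^ n * z"
    using assms(1) by (auto simp: p_ideal_iff)
  have "x = of_nat p ^ m * (of_nat p ^ (n - m) * z)"
    using z(2) assms(2) by (simp add: mult.assoc[symmetric] power_add[symmetric])
  with z(1) show ?thesis by blast
qed

lemma p_ideal_imp_p_integers: "x \<in> p_ideal p n \<Longrightarrow> x \<in> p_integers p"
  using p_ideal_antimono[of x n 0] by (simp add: p_ideal_0)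

section \<open>Expansion of one factor modulo \<open>p ^ 6\<close>, and integrality of Bernoulli
  numbers\<close>

text \<open>In the binomial expansion the terms of degree at least 6 carry \<open>P ^ 6\<close>, and
  so does degree 5, whose binomial coefficient supplies one more \<open>P\<close>. Extracting
  \<open>1 - P y\<close> from the rest determines the coefficients successively: modulo
  \<open>P ^ 6\<close>, that of \<open>y ^ 3\<close> is \<open>P ^ 4 / 6 - P ^ 5 / 2\<close> plus
  \<open>P\<close> times that of \<open>y ^ 2\<close>, and that of \<open>y ^ 4\<close> is
  \<open>P ^ 5 / 12\<close> plus \<open>P\<close> times that of \<open>y ^ 3\<close>.\<close>

lemma one_minus_power_cong:
  fixes y :: rat
  assumes p: "p > 5" and y: "y \<in> p_integers p"
  defines "P \<equiv> (of_nat p :: rat)"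
  shows "(1 - P / (P + 1) * y) ^ (p + 1)
    - (1 - P * y) * (1 + ((P ^ 3 - P ^ 4 + P ^ 5) / 2 * y ^ 2 + (2 / 3 * P ^ 4 - P ^ 5) * y ^ 3
        + 3 / 4 * P ^ 5 * y ^ 4)) \<in> p_ideal p 6"
proof -
  define v where "v = 1 / (P + 1)"
  have P0: "P > 0" using p by (simp add: P_def)
  have "\<not> int p dvd int p + 1" using prime_gt_1_nat[OF prime_p]
    by (metis dvd_add_right_iff dvd_refl of_nat_1 of_nat_dvd_iff nat_dvd_1_iff_1 less_irrefl)
  then have v: "v \<in> p_integers p"
    using p_integers_divide_of_int[of 1 "int p + 1"] by (simp add: v_def P_def add.commute)
  have PZ: "P \<in> p_integers p" by (simp add: P_def)
  define f where "f = (\<lambda>i. of_nat ((p + 1) choose i) * (- (P * v * y)) ^ i)"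
  have "(1 - P / (P + 1) * y) ^ (p + 1) = (- (P * v * y) + 1) ^ (p + 1)"
    by (simp add: v_def)
  also have "\<dots> = sum f {..p + 1}"
    unfolding binomial_ring by (simp add: f_def)
  also have "\<dots> = sum f {..5} + sum f {6..p + 1}"
  proof -
    have "{..p + 1} = {..5} \<union> {6..p + 1}" using p by auto
    then show ?thesis by (simp only:) (subst sum.union_disjoint, auto)
  qed
  finally have split: "(1 - P / (P + 1) * y) ^ (p + 1) = sum f {..5} + sum f {6..p + 1}" .
  have tail: "sum f {6..p + 1} \<in> p_ideal p 6"
  proof (rule p_ideal_sum)
    fix i assume "i \<in> {6..p + 1}"
    have "P ^ 1 * - (v * y) \<in> p_ideal p 1" unfolding P_def using v y by blast
    then have "(P ^ 1 * - (v * y)) ^ i \<in> p_ideal p (1 * i)" by (rule p_ideal_power)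
    then have "(- (P * v * y)) ^ i \<in> p_ideal p 6"
      using \<open>i \<in> _\<close> by (auto simp: mult.assoc intro: p_ideal_antimono)
    then show "f i \<in> p_ideal p 6" unfolding f_def by blast
  qed
  have gb: "of_nat ((p + 1) choose k) = (\<Prod>i=0..<k. P + 1 - of_nat i) / fact k" for k
    by (simp add: binomial_gbinomial gbinomial_prod_rev P_def add.commute)
  have c2: "of_nat ((p + 1) choose 2) = (P + 1) * P / 2"
    unfolding gb by (simp add: numeral_eq_Suc)
  have c3: "of_nat ((p + 1) choose 3) = (P + 1) * P * (P - 1) / 6"
    unfolding gb by (simp add: numeral_eq_Suc)
  have c4: "of_nat ((p + 1) choose 4) = (P + 1) * P * (P - 1) * (P - 2) / 24"
    unfolding gb by (simp add: numeral_eq_Suc)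
  have c5: "of_nat ((p + 1) choose 5) = (P + 1) * P * (P - 1) * (P - 2) * (P - 3) / 120"
    unfolding gb by (simp add: numeral_eq_Suc)
  have Pv: "P * v = 1 - v" using P0 by (simp add: v_def field_simps)
  have Pv: "(P + 1) * v = 1" using P0 by (simp add: v_def)
  have "sum f {..5} = f 0 + f 1 + f 2 + f 3 + f 4 + f 5"
    by (simp add: numeral_eq_Suc)
  also have "f 0 = 1" by (simp add: f_def)
  also have "f 1 = - ((P + 1) * v) * (P * y)" by (simp add: f_def P_def algebra_simps)
  also have "f 2 = ((P + 1) * v) * (P ^ 3 * v / 2 * y ^ 2)"
    unfolding f_def c2 by (simp add: power2_eq_square power3_eq_cube)
  also have "f 3 = - ((P + 1) * v) * ((P - 1) * P ^ 4 * v ^ 2 / 6 * y ^ 3)"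
    unfolding f_def c3 by (simp add: eval_nat_numeral)
  also have "f 4 = ((P + 1) * v) * ((P - 1) * (P - 2) * P ^ 5 * v ^ 3 / 24 * y ^ 4)"
    unfolding f_def c4 by (simp add: eval_nat_numeral)
  also have "f 5 = - ((P + 1) * v) * ((P - 1) * (P - 2) * (P - 3) * P ^ 6 * v ^ 4 / 120 * y ^ 5)"
    unfolding f_def c5 by (simp add: eval_nat_numeral)
  finally have head: "sum f {..5} = 1 - P * y + P ^ 3 * v / 2 * y ^ 2
     - (P - 1) * P ^ 4 * v ^ 2 / 6 * y ^ 3 + (P - 1) * (P - 2) * P ^ 5 * v ^ 3 / 24 * y ^ 4
     - (P - 1) * (P - 2) * (P - 3) * P ^ 6 * v ^ 4 / 120 * y ^ 5"
    unfolding Pv by simp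
  note expand = inverse_successor_expansions[OF Pv]
  \<comment> \<open>The exact cofactor of \<open>P ^ 6\<close>: remainders of the expansions, the
    degree 5 term and the overflow from multiplying by \<open>1 - P y\<close>. Denominators are
    split into 2, 3 and 5, which are units because \<open>p > 5\<close>.\<close>
  define Z where "Z = - v / 2 * y ^ 2
    + ((2 - (P - 1) * (2 * v + v ^ 2)) / 2 / 3 + 1 / 2) * y ^ 3
    + ((P - 3 - (P - 1) * (P - 2) * (v + v ^ 2 + v ^ 3)) / 2 / 2 / 2 / 3 - 1) * y ^ 4
    + (3 / 2 / 2 - (P - 1) * (P - 2) * (P - 3) * v ^ 4 / 2 / 2 / 2 / 3 / 5) * y ^ 5"
  have div: "x / 2 \<in> p_integers p" "x / 3 \<in> p_integers p" "x / 5 \<in> p_integers p"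
    if "x \<in> p_integers p" for x
    using p_integers_divide_of_nat[OF that, of 2] p_integers_divide_of_nat[OF that, of 3]
      p_integers_divide_of_nat[OF that, of 5] p by simp_all
  have Z: "Z \<in> p_integers p" unfolding Z_def
    by (intro p_integers_add p_integers_diff p_integers_mult p_integers_uminus p_integers_power
        div p_integers_consts PZ v y)
  have "sum f {..5} - (1 - P * y) * (1 + ((P ^ 3 - P ^ 4 + P ^ 5) / 2 * y ^ 2
      + (2 / 3 * P ^ 4 - P ^ 5) * y ^ 3 + 3 / 4 * P ^ 5 * y ^ 4)) = P ^ 6 * Z"
    unfolding head expand Z_def by (simp add: field_simps eval_nat_numeral)
  then have "sum f {..5} - (1 - P * y) * (1 + ((P ^ 3 - P ^ 4 + P ^ 5) / 2 * y ^ 2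
      + (2 / 3 * P ^ 4 - P ^ 5) * y ^ 3 + 3 / 4 * P ^ 5 * y ^ 4)) \<in> p_ideal p 6"
    using Z by (auto simp: P_def)
  from p_ideal_add[OF this tail] show ?thesis unfolding split by (simp add: algebra_simps)
qed

text \<open>For \<open>l \<le> p - 2\<close> the recursion only divides by integers below \<open>p\<close>.\<close>

lemma bernoulli_p_integers: "l \<le> p - 2 \<Longrightarrow> bernoulli l \<in> p_integers p"
proof (induction l rule: less_induct)
  case (less l)
  show ?case
  proof (cases l)
    case (Suc n)
    have "bernoulli k \<in> p_integers p" if "k \<le> n" for k
      using less that Suc by simp
    then have "- (\<Sum>k\<le>n. of_nat ((n + 2) choose k) * bernoulli k) \<in> p_integers p"
      by (intro p_integers_uminus p_integers_sum p_integers_mult) auto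
    then have "- (\<Sum>k\<le>n. of_nat ((n + 2) choose k) * bernoulli k) / of_nat (n + 2) \<in> p_integers p"
      using less.prems Suc by (intro p_integers_divide_of_nat) auto
    then show ?thesis by (simp only: Suc bernoulli.simps)
  qed simp
qed

section \<open>Harmonic sums modulo powers of \<open>p\<close>\<close>

lemma inverse_power_p_integers:
  assumes "0 < j" "j < p"
  shows "1 / of_nat j ^ r \<in> p_integers p"
  using p_integers_power[OF p_integers_divide_of_nat[OF p_integers_consts(2) assms], of r]
  by (simp add: power_one_over)

lemma harm_pow_p_integers: "k < p \<Longrightarrow> harm_pow r k \<in> p_integers p"
  unfolding harm_pow_def by (intro p_integers_sum inverse_power_p_integers) auto

text \<open>In Faulhaber's formula at \<open>j = p\<close> every term has a factor \<open>p\<close>,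
  the Bernoulli numbers involved are \<open>p\<close>-integral, and the division by
  \<open>m + 1 < p\<close> is harmless.\<close>

lemma power_sum_p_ideal:
  assumes "0 < m" "m \<le> p - 2"
  shows "(\<Sum>i=1..p-1. of_nat i ^ m) \<in> p_ideal p 1"
proof -
  have "of_nat (Suc m choose l) * bernoulli l * of_nat p ^ (Suc m - l) \<in> p_ideal p 1"
    if "l \<le> m" for l
  proof -
    have "of_nat p ^ (Suc m - l) * (of_nat (Suc m choose l) * bernoulli l) \<in> p_ideal p (Suc m - l)"
      using that assms bernoulli_p_integers[of l]
      by (intro p_ideal_prime_power_mult p_integers_mult) auto
    then show ?thesis using that by (auto simp: mult_ac intro: p_ideal_antimono)
  qed
  then have "(1 / of_nat (Suc m)) * (of_nat (Suc m) * (\<Sum>i<p. of_nat i ^ m)) \<in> p_ideal p 1"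
    unfolding faulhaber using assms
    by (intro p_ideal_mult_left[of "1 / of_nat (Suc m)"] p_ideal_sum p_integers_divide_of_nat)
       (auto simp del: of_nat_Suc)
  moreover have "(\<Sum>i<p. of_nat i ^ m) = (\<Sum>i=1..p-1. of_nat i ^ m :: rat)"
    using assms by (intro sum.mono_neutral_right) (auto simp: not_less_eq_eq)
  ultimately show ?thesis by (simp del: of_nat_Suc)
qed

lemma fermat_p_ideal:
  assumes "0 < j" "j < p"
  shows "of_nat j ^ (p - 1) - 1 \<in> p_ideal p 1"
proof -
  have "[j ^ (p - 1) = 1] (mod p)"
    using assms prime_p by (intro fermat_theorem) (auto simp: nat_dvd_not_less)
  then have "int p dvd int j ^ (p - 1) - 1"
    by (metis cong_iff_dvd_diff cong_int_iff of_nat_1 of_nat_power)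
  then obtain c where "int j ^ (p - 1) - 1 = int p * c" by blast
  then have "(of_nat j ^ (p - 1) - 1 :: rat) = of_nat p ^ 1 * of_int c"
    by (metis of_int_1 of_int_diff of_int_mult of_int_of_nat_eq of_int_power power_one_right)
  then show ?thesis by (simp only: p_ideal_prime_power_mult p_integers_of_int)
qed

lemma inverse_power_cong:
  assumes "0 < j" "j < p" "r \<le> p - 1"
  shows "1 / of_nat j ^ r - of_nat j ^ (p - 1 - r) \<in> p_ideal p 1"
proof -
  have "of_nat j ^ (p - 1) = (of_nat j ^ (p - 1 - r) * of_nat j ^ r :: rat)"
    using assms by (simp add: power_add[symmetric])
  then have "1 / of_nat j ^ r - of_nat j ^ (p - 1 - r)
      = - (1 / of_nat j ^ r) * (of_nat j ^ (p - 1) - 1 :: rat)"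
    using assms by (simp add: field_simps)
  then show ?thesis
    using p_ideal_mult_left[OF p_integers_uminus fermat_p_ideal]
      inverse_power_p_integers assms by metis
qed

text \<open>By Fermat this is a power sum with exponent \<open>p - 1 - r\<close>, which lies between
  1 and \<open>p - 2\<close>.\<close>

lemma harm_pow_p_ideal:
  assumes "0 < r" "r \<le> p - 2"
  shows "harm_pow r (p - 1) \<in> p_ideal p 1"
proof -
  have 1: "(\<Sum>j=1..p-1. 1 / of_nat j ^ r - of_nat j ^ (p - 1 - r)) \<in> p_ideal p 1"
    using assms by (intro p_ideal_sum inverse_power_cong) auto
  have 2: "(\<Sum>j=1..p-1. of_nat j ^ (p - 1 - r)) \<in> p_ideal p 1"
    using assms by (intro power_sum_p_ideal) auto
  show ?thesis
    using p_ideal_add[OF 1 2] by (simp add: harm_pow_def sum_subtractf)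
qed

lemma harm_pow_cong_power_sum:
  assumes "i \<le> p" "p > 2"
  shows "harm_pow 1 (i - 1) - (\<Sum>a<i. of_nat a ^ (p - 2)) \<in> p_ideal p 1"
proof -
  have "(\<Sum>a<i. of_nat a ^ (p - 2)) = (\<Sum>a=1..i-1. of_nat a ^ (p - 2) :: rat)"
    using assms by (intro sum.mono_neutral_right) (auto simp: not_less_eq_eq)
  moreover have "(\<Sum>a=1..i-1. 1 / of_nat a ^ 1 - of_nat a ^ (p - 1 - 1)) \<in> p_ideal p 1"
    using assms by (intro p_ideal_sum inverse_power_cong) auto
  ultimately show ?thesis by (simp add: harm_pow_def sum_subtractf diff_diff_eq numeral_2_eq_2)
qed

text \<open>Faulhaber's formula with exponent \<open>p - 2\<close> replaces the inner harmonic sum.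
  After division by \<open>i ^ 2\<close> and summation over \<open>i\<close>, the index
  \<open>l\<close> yields the exponent \<open>p - 3 - l\<close>. Only exponent 0 survives modulo
  \<open>p\<close>, that is \<open>l = p - 3\<close>.\<close>

lemma harmonic_bernoulli_cong:
  assumes p: "p > 5"
  shows "(\<Sum>i=1..p-1. harm_pow 1 i / of_nat i ^ 2) - bernoulli (p - 3) \<in> p_ideal p 1"
proof -
  have inv: "1 / of_nat i ^ r \<in> p_integers p" if "i \<in> {1..p-1}" for i r
    using that by (intro inverse_power_p_integers) auto
  define c where "c = (\<lambda>l. of_nat (p - 1 choose l) * bernoulli l)"
  have c: "c l \<in> p_integers p" if "l \<le> p - 2" for l
    using that bernoulli_p_integers by (auto simp: c_def)
  define e where "e = (\<lambda>l. \<Sum>i=1..p-1. of_nat i ^ (p - 1 - l) / of_nat i ^ 2 :: rat)"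
  have diff: "(\<Sum>i=1..p-1. (harm_pow 1 (i - 1) - (\<Sum>a<i. of_nat a ^ (p - 2))) * (1 / of_nat i ^ 2))
      \<in> p_ideal p 1"
    using p by (intro p_ideal_sum p_ideal_mult_right harm_pow_cong_power_sum inv) auto
  \<comment> \<open>Faulhaber sums over \<open>a < i\<close>, so the term \<open>a = i\<close> is
    split off; it contributes \<open>harm_pow 3 (p - 1)\<close>, a multiple of
    \<open>p\<close>.\<close>
  have shift: "(\<Sum>i=1..p-1. harm_pow 1 i / of_nat i ^ 2)
      = (\<Sum>i=1..p-1. harm_pow 1 (i - 1) * (1 / of_nat i ^ 2)) + harm_pow 3 (p - 1)"
  proof -
    have "harm_pow 1 i / of_nat i ^ 2 = harm_pow 1 (i - 1) * (1 / of_nat i ^ 2) + 1 / of_nat i ^ 3"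
      if "i \<in> {1..p-1}" for i
      using that by (cases i) (auto simp: harm_pow_def add_divide_distrib eval_nat_numeral)
    then show ?thesis unfolding harm_pow_def[of 3] sum.distrib[symmetric]
      by (intro sum.cong) auto
  qed
  have "harm_pow 3 (p - 1) \<in> p_ideal p 1"
    using p by (intro harm_pow_p_ideal) auto
  from p_ideal_add[OF diff this] have 1: "(\<Sum>i=1..p-1. harm_pow 1 i / of_nat i ^ 2)
      - (\<Sum>i=1..p-1. (\<Sum>a<i. of_nat a ^ (p - 2)) * (1 / of_nat i ^ 2)) \<in> p_ideal p 1"
    unfolding shift left_diff_distrib sum_subtractf by (simp only: algebra_simps)
  have "(\<Sum>i=1..p-1. (\<Sum>a<i. of_nat a ^ (p - 2)) * (1 / of_nat i ^ 2))
     = (\<Sum>i=1..p-1. (\<Sum>l\<le>p-2. c l * of_nat i ^ (p - 1 - l)) / of_nat (p - 1) * (1 / of_nat i ^ 2))"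
  proof (intro sum.cong refl)
    fix i
    have "Suc (p - 2) = p - 1" using p by simp
    then have "of_nat (p - 1) * (\<Sum>a<i. of_nat a ^ (p - 2))
        = (\<Sum>l\<le>p-2. c l * of_nat i ^ (p - 1 - l))"
      using faulhaber[of "p - 2" i] by (simp only: c_def)
    moreover have "of_nat (p - 1) \<noteq> (0 :: rat)" using p by simp
    ultimately have "(\<Sum>a<i. of_nat a ^ (p - 2))
        = (\<Sum>l\<le>p-2. c l * of_nat i ^ (p - 1 - l)) / of_nat (p - 1)"
      by (metis nonzero_mult_div_cancel_left)
    then show "(\<Sum>a<i. of_nat a ^ (p - 2)) * (1 / of_nat i ^ 2)
     = (\<Sum>l\<le>p-2. c l * of_nat i ^ (p - 1 - l)) / of_nat (p - 1) * (1 / of_nat i ^ 2)"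
      by (simp only:)
  qed
  also have "\<dots> = (\<Sum>l\<le>p-2. c l * e l) / of_nat (p - 1)"
    by (simp add: e_def sum_distrib_left sum_divide_distrib sum_distrib_right field_simps)
       (rule sum.swap)
  also have "(\<Sum>l\<le>p-2. c l * e l) = (\<Sum>l\<le>p-4. c l * e l) + c (p - 3) * e (p - 3) + c (p - 2) * e (p - 2)"
  proof -
    have eq: "{..p-2} = insert (p - 2) (insert (p - 3) {..p - 4})" using p by auto
    have "p - 2 \<notin> insert (p - 3) {..p - 4}" "p - 3 \<notin> {..p - 4}" using p by auto
    then show ?thesis unfolding eq by (simp add: add_ac)
  qed
  also have "e (p - 3) = of_nat (p - 1)"
    using p by (simp add: e_def)
  also have "e (p - 2) = harm_pow 1 (p - 1)"
    unfolding e_def harm_pow_def using p by (intro sum.cong) (auto simp: power2_eq_square)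
  finally have 2: "(\<Sum>i=1..p-1. (\<Sum>a<i. of_nat a ^ (p - 2)) * (1 / of_nat i ^ 2))
      = ((\<Sum>l\<le>p-4. c l * e l) + c (p - 2) * harm_pow 1 (p - 1)) / of_nat (p - 1) + c (p - 3)"
    using p by (simp add: add_divide_distrib)
  have "e l \<in> p_ideal p 1" if "l \<le> p - 4" for l
  proof -
    have "e l = (\<Sum>i=1..p-1. of_nat i ^ (p - 3 - l))"
      unfolding e_def
    proof (intro sum.cong refl)
      fix i assume "i \<in> {1..p-1}"
      moreover have "p - 1 - l = (p - 3 - l) + 2" using that p by simp
      ultimately show "of_nat i ^ (p - 1 - l) / of_nat i ^ 2 = (of_nat i ^ (p - 3 - l) :: rat)"
        by (simp only: power_add) simp
    qed
    then show ?thesis using power_sum_p_ideal[of "p - 3 - l"] that p by simp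
  qed
  then have "(\<Sum>l\<le>p-4. c l * e l) + c (p - 2) * harm_pow 1 (p - 1) \<in> p_ideal p 1"
    using p by (intro p_ideal_add p_ideal_sum p_ideal_mult_left c harm_pow_p_ideal) auto
  then have 3: "((\<Sum>l\<le>p-4. c l * e l) + c (p - 2) * harm_pow 1 (p - 1)) / of_nat (p - 1) \<in> p_ideal p 1"
    using p_ideal_mult_right[OF _ inverse_power_p_integers[of "p - 1" 1]] p by fastforce
  \<comment> \<open>The coefficient is
    \<open>(p - 1) (p - 2) / 2 = 1 + p (p - 3) / 2\<close>.\<close>
  have "c (p - 3) - bernoulli (p - 3) \<in> p_ideal p 1"
  proof -
    have "p - 1 choose (p - 3) = p - 1 choose 2"
      using binomial_symmetric[of 2 "p - 1"] p by (simp add: numeral_eq_Suc)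
    moreover have "of_nat (p - 1 choose 2) = of_nat (p - 1) * (of_nat (p - 1) - 1) / (2 :: rat)"
      by (simp add: binomial_gbinomial gbinomial_prod_rev numeral_2_eq_2)
    moreover have "of_nat (p - 1) = (of_nat p - 1 :: rat)"
      using p by (simp add: of_nat_diff)
    ultimately have "c (p - 3) = (of_nat p - 1) * (of_nat p - 1 - 1) / 2 * bernoulli (p - 3)"
      by (simp only: c_def)
    then have "c (p - 3) - bernoulli (p - 3)
        = of_nat p ^ 1 * ((of_nat p - 3) * (1 / of_nat 2) * bernoulli (p - 3))"
      by (simp add: field_simps)
    also have "\<dots> \<in> p_ideal p 1"
      using p by (intro p_ideal_prime_power_mult p_integers_mult p_integers_diff
          p_integers_divide_of_nat bernoulli_p_integers) auto
    finally show ?thesis .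
  qed
  from p_ideal_add[OF p_ideal_add[OF 1 3] this] show ?thesis
    unfolding 2 by (simp add: algebra_simps)
qed

section \<open>The harmonic numbers \<open>H(1)\<close> and \<open>H(2)\<close>\<close>

text \<open>Expanding \<open>1 / (p - j)\<close> as a geometric series in \<open>p / j\<close> gives
  \<open>- 1/j - p/j^2 - p^2/j^3\<close> with remainder \<open>p^3 / (j^3 (p - j))\<close>. The sum
  of the cubic terms is itself divisible by \<open>p\<close>.\<close>

lemma harm_pow_1_2:
  assumes p: "p > 5"
  shows "2 * harm_pow 1 (p - 1) + of_nat p * harm_pow 2 (p - 1) \<in> p_ideal p 3"
proof -
  have "harm_pow 1 (p - 1) = (\<Sum>j=1..p-1. 1 / of_nat (p - j))"
    unfolding harm_pow_def power_one_right
    by (rule sum.reindex_bij_witness[of _ "\<lambda>j. p - j" "\<lambda>j. p - j"]) auto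
  then have "2 * harm_pow 1 (p - 1) + of_nat p * harm_pow 2 (p - 1) + of_nat p ^ 2 * harm_pow 3 (p - 1)
    = (\<Sum>j=1..p-1. 1 / of_nat (p - j) + 1 / of_nat j + of_nat p / of_nat j ^ 2 + of_nat p ^ 2 / of_nat j ^ 3)"
    by (simp add: harm_pow_def sum.distrib sum_distrib_left)
  also have "\<dots> = (\<Sum>j=1..p-1. of_nat p ^ 3 * ((1 / of_nat (p - j) ^ 1) * (1 / of_nat j ^ 3)))"
  proof (intro sum.cong refl)
    fix j assume "j \<in> {1..p-1}"
    then have "j < p" "0 < j" using p by auto
    then have "of_nat p \<noteq> (of_nat j :: rat)" by simp
    with \<open>0 < j\<close> show "1 / of_nat (p - j) + 1 / of_nat j + of_nat p / of_nat j ^ 2 + of_nat p ^ 2 / of_nat j ^ 3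
      = (of_nat p ^ 3 * ((1 / of_nat (p - j) ^ 1) * (1 / of_nat j ^ 3)) :: rat)"
      using \<open>j < p\<close> by (simp add: of_nat_diff field_simps eval_nat_numeral)
  qed
  also have "\<dots> \<in> p_ideal p 3"
    using p by (intro p_ideal_sum p_ideal_prime_power_mult p_integers_mult inverse_power_p_integers) auto
  finally have 1: "2 * harm_pow 1 (p - 1) + of_nat p * harm_pow 2 (p - 1)
      + of_nat p ^ 2 * harm_pow 3 (p - 1) \<in> p_ideal p 3" .
  have "of_nat p ^ 2 * 1 \<in> p_ideal p 2" by (rule p_ideal_prime_power_mult) simp
  from p_ideal_mult[OF this harm_pow_p_ideal[of 3]] p
  have "of_nat p ^ 2 * harm_pow 3 (p - 1) \<in> p_ideal p 3" by simp
  from p_ideal_diff[OF 1 this] show ?thesis by simp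
qed

lemma binomial_weight_p_integers: "k < p \<Longrightarrow> binomial_weight p k \<in> p_integers p"
  by (simp add: binomial_weight_eq prime_gt_0_nat[OF prime_p] p_integers_mult p_integers_power
      p_integers_uminus)

lemma prime_mult_p_ideal: "x \<in> p_ideal p n \<Longrightarrow> of_nat p * x \<in> p_ideal p (Suc n)"
  using p_ideal_mult[of "of_nat p ^ 1 * 1" 1 x n] p_ideal_prime_power_mult[of 1 1] by simp

text \<open>Multiplying out the product, only the part linear in \<open>p\<close> survives modulo
  \<open>p ^ 2\<close>.\<close>

lemma binomial_weight_cong:
  "k < p \<Longrightarrow> binomial_weight p k - (1 - of_nat p * harm_pow 1 k) \<in> p_ideal p 2"
proof (induction k)
  case (Suc k)
  define x :: rat where "x = 1 / of_nat (Suc k)"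
  have x: "x \<in> p_integers p"
    using inverse_power_p_integers[of "Suc k" 1] Suc.prems by (simp add: x_def)
  have "1 - of_nat p * x \<in> p_integers p" using x by blast
  then have 1: "(binomial_weight p k - (1 - of_nat p * harm_pow 1 k)) * (1 - of_nat p * x) \<in> p_ideal p 2"
    using Suc by (intro p_ideal_mult_right) auto
  have 2: "of_nat p ^ 2 * (harm_pow 1 k * x) \<in> p_ideal p 2"
    using harm_pow_p_integers[of k 1] x Suc.prems by (intro p_ideal_prime_power_mult p_integers_mult) auto
  have "binomial_weight p (Suc k) = binomial_weight p k * (1 - of_nat p * x)"
      "harm_pow 1 (Suc k) = harm_pow 1 k + x"
    by (simp_all add: binomial_weight_Suc harm_pow_Suc x_def)
  then have "binomial_weight p (Suc k) - (1 - of_nat p * harm_pow 1 (Suc k))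
     = (binomial_weight p k - (1 - of_nat p * harm_pow 1 k)) * (1 - of_nat p * x)
       + of_nat p ^ 2 * (harm_pow 1 k * x)"
    by (simp add: algebra_simps power2_eq_square)
  with p_ideal_add[OF 1 2] show ?case by (simp only:)
qed simp

lemma harm_pow_2_cong:
  assumes p: "p > 5"
  shows "harm_pow 2 (p - 1) - 2 / 3 * of_nat p * bernoulli (p - 3) \<in> p_ideal p 2"
proof -
  define H1 H2 T where "H1 = harm_pow 1 (p - 1)" and "H2 = harm_pow 2 (p - 1)"
    and "T = (\<Sum>i=1..p-1. harm_pow 1 i / of_nat i ^ 2)"
  have "(\<Sum>i=1..p-1. (binomial_weight p i - (1 - of_nat p * harm_pow 1 i)) * (1 / of_nat i ^ 2)) \<in> p_ideal p 2"
    using p by (intro p_ideal_sum p_ideal_mult_right binomial_weight_cong inverse_power_p_integers) auto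
  moreover have "(\<Sum>i=1..p-1. (binomial_weight p i - (1 - of_nat p * harm_pow 1 i)) * (1 / of_nat i ^ 2))
      = (\<Sum>i=1..p-1. binomial_weight p i / of_nat i ^ 2) - H2 + of_nat p * T"
    by (simp add: H2_def T_def harm_pow_def[of 2] left_diff_distrib diff_divide_distrib sum_subtractf sum_distrib_left)
  moreover have "(\<Sum>i=1..p-1. binomial_weight p i / of_nat i ^ 2) = - ((H1 ^ 2 + H2) / 2)"
    using sum_binomial_weight[OF prime_gt_0_nat[OF prime_p], of 2]
    by (simp only: alt_binomial_sum_2 H1_def H2_def)
  ultimately have 1: "- ((H1 ^ 2 + H2) / 2) - H2 + of_nat p * T \<in> p_ideal p 2" by simp
  have "H1 \<in> p_ideal p 1" unfolding H1_def using p by (intro harm_pow_p_ideal) auto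
  then have "H1 ^ 2 \<in> p_ideal p 2" using p_ideal_power[of H1 1 2] by simp
  then have 2: "(1 / 2) * H1 ^ 2 \<in> p_ideal p 2"
    using p_integers_divide_of_nat[of 1 2] p by (intro p_ideal_mult_left) auto
  have "T - bernoulli (p - 3) \<in> p_ideal p 1"
    unfolding T_def by (rule harmonic_bernoulli_cong[OF p])
  then have 3: "of_nat p * (T - bernoulli (p - 3)) \<in> p_ideal p 2"
    using prime_mult_p_ideal[of _ 1] by (simp add: numeral_2_eq_2)
  have "2 * (1 / 3) \<in> p_integers p"
    using p_integers_divide_of_nat[of 1 3] p by (intro p_integers_mult) auto
  \<comment> \<open>In this combination \<open>T\<close> and \<open>H1 ^ 2\<close> cancel and
    \<open>3 / 2 * H2\<close> remains, whence the factor \<open>2 / 3\<close>.\<close>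
  then have "2 * (1 / 3) * (of_nat p * (T - bernoulli (p - 3)) - (- ((H1 ^ 2 + H2) / 2) - H2 + of_nat p * T)
      - (1 / 2) * H1 ^ 2) \<in> p_ideal p 2"
    by (intro p_ideal_mult_left p_ideal_diff 1 2 3)
  also have "2 * (1 / 3) * (of_nat p * (T - bernoulli (p - 3)) - (- ((H1 ^ 2 + H2) / 2) - H2 + of_nat p * T)
      - (1 / 2) * H1 ^ 2) = harm_pow 2 (p - 1) - 2 / 3 * of_nat p * bernoulli (p - 3)"
    by (simp add: H2_def field_simps)
  finally show ?thesis .
qed

text \<open>The factor \<open>p\<close> in \<open>2 H(1) + p H(2)\<close> lifts the congruence for
  \<open>H(2)\<close> from modulus \<open>p ^ 2\<close> to \<open>p ^ 3\<close>.\<close>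

lemma harm_pow_1_cong:
  assumes p: "p > 5"
  shows "harm_pow 1 (p - 1) + 1 / 3 * of_nat p ^ 2 * bernoulli (p - 3) \<in> p_ideal p 3"
proof -
  have "of_nat p * (harm_pow 2 (p - 1) - 2 / 3 * of_nat p * bernoulli (p - 3)) \<in> p_ideal p 3"
    using prime_mult_p_ideal[OF harm_pow_2_cong[OF p]] by (simp add: numeral_3_eq_3)
  note p_ideal_diff[OF harm_pow_1_2[OF p] this]
  moreover have "1 / 2 \<in> p_integers p"
    using p_integers_divide_of_nat[of 1 2] p by simp
  ultimately have "1 / 2 * (2 * harm_pow 1 (p - 1) + of_nat p * harm_pow 2 (p - 1)
      - of_nat p * (harm_pow 2 (p - 1) - 2 / 3 * of_nat p * bernoulli (p - 3))) \<in> p_ideal p 3"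
    by (rule p_ideal_mult_left[rotated])
  also have "1 / 2 * (2 * harm_pow 1 (p - 1) + of_nat p * harm_pow 2 (p - 1)
      - of_nat p * (harm_pow 2 (p - 1) - 2 / 3 * of_nat p * bernoulli (p - 3)))
    = harm_pow 1 (p - 1) + 1 / 3 * of_nat p ^ 2 * bernoulli (p - 3)"
    by (simp add: field_simps power2_eq_square)
  finally show ?thesis .
qed

section \<open>The weighted harmonic sums\<close>

text \<open>Modulo \<open>p\<close> the weights are 1, so summation by parts leaves
  \<open>(H(2) - H(3)) / (p - 2)\<close>, and \<open>p\<close> divides both harmonic
  numbers.\<close>

lemma weighted_harm_pow_4_p_ideal:
  assumes p: "p > 5"
  shows "(\<Sum>k=0..p-1. of_nat k * binomial_weight p k * harm_pow 4 k) \<in> p_ideal p 1"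
proof -
  have w: "binomial_weight p i - 1 \<in> p_ideal p 1" if "i < p" for i
  proof -
    have "binomial_weight p i - (1 - of_nat p * harm_pow 1 i) \<in> p_ideal p 1"
      using p_ideal_antimono[OF binomial_weight_cong[OF that], of 1] by simp
    moreover have "of_nat p ^ 1 * harm_pow 1 i \<in> p_ideal p 1"
      using harm_pow_p_integers[OF that] by blast
    ultimately show ?thesis using p_ideal_diff by fastforce
  qed
  have S: "(\<Sum>i=1..p-1. binomial_weight p i / of_nat i ^ r) \<in> p_ideal p 1" if "0 < r" "r \<le> p - 2" for r
  proof -
    have "(\<Sum>i=1..p-1. (binomial_weight p i - 1) * (1 / of_nat i ^ r)) \<in> p_ideal p 1"
      by (intro p_ideal_sum p_ideal_mult_right w inverse_power_p_integers) auto
    from p_ideal_add[OF this harm_pow_p_ideal[OF that]] show ?thesis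
      by (simp add: harm_pow_def diff_divide_distrib sum_subtractf)
  qed
  have "(\<Sum>i=1..p-1. binomial_weight p i / of_nat i ^ 2 - binomial_weight p i / of_nat i ^ 3)
     * (1 / of_nat (p - 2)) \<in> p_ideal p 1"
    unfolding sum_subtractf using p
    by (intro p_ideal_mult_right p_ideal_diff S p_integers_divide_of_nat) auto
  then show ?thesis using sum_binomial_weight_harm_pow[of p 2] p
    by (simp add: eval_nat_numeral of_nat_diff)
qed

text \<open>The sum is exactly \<open>((H(1)^2 + H(2)) / 2 - H(1)) / (p - 2)\<close>. Modulo
  \<open>p ^ 2\<close> only \<open>H(2) / 2\<close>, congruent to \<open>p B / 3\<close>, survives
  in the numerator, and \<open>p - 2\<close> acts as \<open>-2\<close> on it.\<close>

lemma weighted_harm_pow_3_cong: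
  assumes p: "p > 5"
  shows "(\<Sum>k=0..p-1. of_nat k * binomial_weight p k * harm_pow 3 k)
    + 1 / 6 * of_nat p * bernoulli (p - 3) \<in> p_ideal p 2"
proof -
  define P B H1 H2 where "P = (of_nat p :: rat)" and "B = bernoulli (p - 3)"
    and "H1 = harm_pow 1 (p - 1)" and "H2 = harm_pow 2 (p - 1)"
  have P2: "P - 2 = of_nat (p - 2)" "P - 2 \<noteq> 0" using p by (simp_all add: P_def of_nat_diff)
  have B: "B \<in> p_integers p" by (simp add: B_def bernoulli_p_integers)
  have half: "1 / 2 \<in> p_integers p" and third: "1 / 3 \<in> p_integers p"
    using p_integers_divide_of_nat[of 1 2] p_integers_divide_of_nat[of 1 3] p by simp_all
  have "H1 + P ^ 2 * (1 / 3 * B) \<in> p_ideal p 2"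
    using p_ideal_antimono[OF harm_pow_1_cong[OF p], of 2] by (simp add: H1_def P_def B_def mult_ac)
  moreover have "P ^ 2 * (1 / 3 * B) \<in> p_ideal p 2"
    unfolding P_def using B third by blast
  ultimately have H1: "H1 \<in> p_ideal p 2" using p_ideal_diff by fastforce
  then have H1sq: "1 / 2 * (H1 * H1) \<in> p_ideal p 2"
    using p_ideal_imp_p_integers half by blast
  have H2: "1 / 2 * (H2 - 2 / 3 * P * B) \<in> p_ideal p 2"
    unfolding H2_def P_def B_def using harm_pow_2_cong[OF p] half by blast
  have PB: "P ^ 2 * (1 / 2 * (1 / 3) * B) \<in> p_ideal p 2"
    unfolding P_def by (intro p_ideal_prime_power_mult p_integers_mult half third B)
  have "(\<Sum>k=0..p-1. of_nat k * binomial_weight p k * harm_pow 3 k)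
      = ((H1 ^ 2 + H2) / 2 - H1) / (P - 2)"
    using sum_binomial_weight_harm_pow[of p 1] p sum_binomial_weight[of p 1] sum_binomial_weight[of p 2]
    unfolding sum_subtractf alt_binomial_sum_1 alt_binomial_sum_2
    by (simp add: numeral_3_eq_3 numeral_2_eq_2 H1_def H2_def P_def)
  also have "\<dots> + 1 / 6 * P * B
      = (- H1 + 1 / 2 * (H1 * H1) + 1 / 2 * (H2 - 2 / 3 * P * B) + P ^ 2 * (1 / 2 * (1 / 3) * B))
        / (P - 2)"
    using P2(2) by (simp add: field_simps power2_eq_square)
  also have "\<dots> = (- H1 + 1 / 2 * (H1 * H1) + 1 / 2 * (H2 - 2 / 3 * P * B)
       + P ^ 2 * (1 / 2 * (1 / 3) * B)) * (1 / of_nat (p - 2))"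
    by (simp add: P2(1))
  also have "\<dots> \<in> p_ideal p 2"
    using p by (intro p_ideal_mult_right[OF _ p_integers_divide_of_nat] p_ideal_add[OF _ PB]
        p_ideal_add[OF _ H2] p_ideal_add[OF p_ideal_uminus[OF H1] H1sq]) auto
  finally show ?thesis by (simp only: P_def B_def)
qed

text \<open>The sum is exactly \<open>(H(1) - 1) / (p - 2)\<close>. The first three terms come from
  expanding \<open>1 / (2 - p)\<close>, the Bernoulli term from \<open>H(1)\<close> divided by
  \<open>-2\<close>.\<close>

lemma weighted_harm_pow_2_cong:
  assumes p: "p > 5"
  shows "(\<Sum>k=0..p-1. of_nat k * binomial_weight p k * harm_pow 2 k)
    - (1 / 2 + of_nat p / 4 + of_nat p ^ 2 / 8 + of_nat p ^ 2 * bernoulli (p - 3) / 6) \<in> p_ideal p 3"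
proof -
  define P B H1 where "P = (of_nat p :: rat)" and "B = bernoulli (p - 3)"
    and "H1 = harm_pow 1 (p - 1)"
  have P2: "P - 2 = of_nat (p - 2)" "P - 2 \<noteq> 0" using p by (simp_all add: P_def of_nat_diff)
  have B: "B \<in> p_integers p" by (simp add: B_def bernoulli_p_integers)
  have half: "1 / 2 \<in> p_integers p" and third: "1 / 3 \<in> p_integers p"
    using p_integers_divide_of_nat[of 1 2] p_integers_divide_of_nat[of 1 3] p by simp_all
  have H1: "H1 + 1 / 3 * P ^ 2 * B \<in> p_ideal p 3"
    unfolding H1_def P_def B_def by (rule harm_pow_1_cong[OF p])
  have P3: "P ^ 3 * ((1 / 2) ^ 3 + 1 / 2 * (1 / 3) * B) \<in> p_ideal p 3"
    unfolding P_def
    by (intro p_ideal_prime_power_mult p_integers_add p_integers_mult p_integers_power half third B)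
  have "(\<Sum>k=0..p-1. of_nat k * binomial_weight p k * harm_pow 2 k) = (H1 - 1) / (P - 2)"
    using sum_binomial_weight_harm_pow[of p 0] p sum_binomial_weight[of p 0] sum_binomial_weight[of p 1]
      alt_binomial_sum_0[of "p - 1"]
    unfolding sum_subtractf alt_binomial_sum_1
    by (simp add: numeral_2_eq_2 H1_def P_def)
  also have "\<dots> - (1 / 2 + P / 4 + P ^ 2 / 8 + P ^ 2 * B / 6)
      = (H1 + 1 / 3 * P ^ 2 * B - P ^ 3 * ((1 / 2) ^ 3 + 1 / 2 * (1 / 3) * B)) / (P - 2)"
    using P2(2) by (simp add: field_simps eval_nat_numeral)
  also have "\<dots> = (H1 + 1 / 3 * P ^ 2 * B - P ^ 3 * ((1 / 2) ^ 3 + 1 / 2 * (1 / 3) * B)) * (1 / of_nat (p - 2))"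
    by (simp add: P2(1))
  also have "\<dots> \<in> p_ideal p 3"
    using p by (intro p_ideal_mult_right[OF _ p_integers_divide_of_nat] p_ideal_diff[OF H1 P3]) auto
  finally show ?thesis by (simp only: P_def B_def)
qed

section \<open>The summand and the final congruence\<close>

text \<open>Passing from \<open>k\<close> to \<open>k + 1\<close> multiplies the ratio by
  \<open>1 - P / (P + 1) / (k + 1)\<close>, whose power is known modulo \<open>p ^ 6\<close>.
  Corrections add up since \<open>(1 + E k) (1 + e)\<close> differs from \<open>1 + E k + e\<close>
  by a product of two multiples of \<open>p ^ 3\<close>.\<close>

lemma pochhammer_ratio_cong:
  fixes P :: rat
  assumes p: "p > 5"
  defines "P \<equiv> of_nat p"
  defines "E \<equiv> \<lambda>k. (P ^ 3 - P ^ 4 + P ^ 5) / 2 * harm_pow 2 k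
      + (2 / 3 * P ^ 4 - P ^ 5) * harm_pow 3 k + 3 / 4 * P ^ 5 * harm_pow 4 k"
  shows "k < p \<Longrightarrow> (pochhammer (1 / (P + 1)) k / fact k) ^ (p + 1)
    - binomial_weight p k * (1 + E k) \<in> p_ideal p 6"
proof (induction k)
  case (Suc k)
  define y :: rat where "y = 1 / of_nat (Suc k)"
  have y: "y \<in> p_integers p"
    using inverse_power_p_integers[of "Suc k" 1] Suc.prems by (simp add: y_def)
  define e where "e = (P ^ 3 - P ^ 4 + P ^ 5) / 2 * y ^ 2 + (2 / 3 * P ^ 4 - P ^ 5) * y ^ 3
        + 3 / 4 * P ^ 5 * y ^ 4"
  define u where "u = (1 - P / (P + 1) * y) ^ (p + 1)"
  define w X where "w = binomial_weight p k" and "X = (pochhammer (1 / (P + 1)) k / fact k) ^ (p + 1)"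
  have half: "1 / 2 \<in> p_integers p" and third: "1 / 3 \<in> p_integers p"
    using p_integers_divide_of_nat[of 1 2] p_integers_divide_of_nat[of 1 3] p by simp_all
  have PZ: "P \<in> p_integers p" by (simp add: P_def)
  have P0: "P + 1 \<noteq> 0" unfolding P_def by (metis of_nat_Suc of_nat_eq_0_iff add.commute nat.simps(3))
  have ideal3: "(P ^ 3 - P ^ 4 + P ^ 5) / 2 * a + (2 / 3 * P ^ 4 - P ^ 5) * b + 3 / 4 * P ^ 5 * c
      \<in> p_ideal p 3" if "a \<in> p_integers p" "b \<in> p_integers p" "c \<in> p_integers p" for a b c
  proof -
    have "P ^ 3 * (1 / 2 * (1 - P + P ^ 2) * a + (2 * (1 / 3) * P - P ^ 2) * b + 3 * (1 / 2) * (1 / 2) * P ^ 2 * c)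
      \<in> p_ideal p 3" unfolding P_def
      by (intro p_ideal_prime_power_mult p_integers_add p_integers_diff p_integers_mult
          p_integers_power half third that p_integers_consts p_integers_of_nat)
    then show ?thesis by (simp add: algebra_simps eval_nat_numeral add_divide_distrib diff_divide_distrib)
  qed
  have E3: "E k \<in> p_ideal p 3" and e3: "e \<in> p_ideal p 3"
    unfolding E_def e_def using Suc.prems y
    by (intro ideal3 harm_pow_p_integers p_integers_power; simp)+
  have EZ: "1 + E k \<in> p_integers p" using p_ideal_imp_p_integers[OF E3] by blast
  have eZ: "1 + e \<in> p_integers p" using p_ideal_imp_p_integers[OF e3] by blast
  have wZ: "w \<in> p_integers p" using Suc.prems by (simp add: w_def binomial_weight_p_integers)
  have u: "u - (1 - P * y) * (1 + e) \<in> p_ideal p 6"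
    unfolding u_def e_def P_def by (rule one_minus_power_cong[OF p y])
  have uZ: "u \<in> p_integers p"
  proof -
    have "(u - (1 - P * y) * (1 + e)) + (1 - P * y) * (1 + e) \<in> p_integers p"
      by (intro p_integers_add[OF p_ideal_imp_p_integers[OF u]] p_integers_mult[OF _ eZ]
          p_integers_diff p_integers_mult PZ y p_integers_consts)
    then show ?thesis by simp
  qed
  have "1 / (P + 1) + of_nat k = of_nat (Suc k) * (1 - P / (P + 1) * y)"
  proof -
    have "of_nat (Suc k) * (1 - P / (P + 1) * y) = of_nat (Suc k) - P / (P + 1) * (of_nat (Suc k) * y)"
      by (simp add: algebra_simps del: of_nat_Suc)
    also have "of_nat (Suc k) * y = 1" by (simp add: y_def)
    also have "of_nat (Suc k) - P / (P + 1) * 1 = of_nat k + (1 - P / (P + 1))" by simp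
    also have "1 - P / (P + 1) = 1 / (P + 1)" using P0 by (simp add: field_simps)
    finally show ?thesis by simp
  qed
  then have "pochhammer (1 / (P + 1)) (Suc k) / fact (Suc k)
      = pochhammer (1 / (P + 1)) k / fact k * (1 - P / (P + 1) * y)"
    by (simp add: pochhammer_Suc del: of_nat_Suc)
  then have ratio: "(pochhammer (1 / (P + 1)) (Suc k) / fact (Suc k)) ^ (p + 1) = X * u"
    by (simp only: power_mult_distrib X_def u_def)
  have weight: "binomial_weight p (Suc k) = w * (1 - P * y)"
    by (simp add: binomial_weight_Suc w_def y_def P_def)
  have ES: "E (Suc k) = E k + e"
  proof -
    have "harm_pow r (Suc k) = harm_pow r k + y ^ r" for r
      by (simp add: harm_pow_Suc y_def power_one_over)
    then show ?thesis unfolding E_def e_def by (simp only: distrib_left add_ac)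
  qed
  \<comment> \<open>This sum telescopes to
    \<open>X * u - w * (1 - P * y) * (1 + E k + e)\<close>.\<close>
  have "(X - w * (1 + E k)) * u + w * (1 + E k) * (u - (1 - P * y) * (1 + e))
      + w * (1 - P * y) * (E k * e) \<in> p_ideal p 6"
  proof (intro p_ideal_add)
    show "(X - w * (1 + E k)) * u \<in> p_ideal p 6"
      using Suc uZ by (intro p_ideal_mult_right) (auto simp: X_def w_def)
    show "w * (1 + E k) * (u - (1 - P * y) * (1 + e)) \<in> p_ideal p 6"
      by (intro p_ideal_mult_left[OF _ u] p_integers_mult wZ EZ)
    have "E k * e \<in> p_ideal p 6" using p_ideal_mult[OF E3 e3] by simp
    then show "w * (1 - P * y) * (E k * e) \<in> p_ideal p 6"
      by (intro p_ideal_mult_left[of "w * (1 - P * y)"] p_integers_mult p_integers_diff wZ PZ y) auto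
  qed
  then show ?case unfolding ratio weight ES by (simp add: algebra_simps)
qed (simp add: E_def)

end

text \<open>The left side is \<open>y\<close> plus an element of the ideal, so its
  \<open>p\<close>-integrality follows from that of \<open>y\<close>.\<close>

lemma p_cong_iff:
  assumes "prime p"
  shows "p_cong p x y (of_nat p ^ n) \<longleftrightarrow> y \<in> p_integers p \<and> x - y \<in> p_ideal p n"
  using p_integers_add[OF assms, of "x - y" y] p_ideal_imp_p_integers[OF assms, of "x - y" n]
  by (auto simp: p_cong_def p_ideal_iff[OF assms])

theorem theorem1p1:
  fixes p :: nat
  assumes "prime p" and "p > 5"
  shows "p_cong p
    (\<Sum>k=0..p-1. of_nat k *
       (pochhammer (1 / of_nat (p + 1)) k ^ (p + 1) / fact k ^ (p + 1)))
    (of_nat p ^ 3 / 4 - of_nat p ^ 4 / 8 + 3 / 16 * of_nat p ^ 5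
       - 1 / 36 * of_nat p ^ 5 * bernoulli (p - 3))
    (of_nat p ^ 6)"
proof -
  note prime = \<open>prime p\<close>
  define P B where "P = (of_nat p :: rat)" and "B = bernoulli (p - 3)"
  define A where "A = (\<lambda>r. \<Sum>k=0..p-1. of_nat k * binomial_weight p k * harm_pow r k)"
  define d2 d3 d4 where "d2 = (P ^ 3 - P ^ 4 + P ^ 5) / 2" and "d3 = 2 / 3 * P ^ 4 - P ^ 5"
    and "d4 = 3 / 4 * P ^ 5"
  define a2 a3 where "a2 = 1 / 2 + P / 4 + P ^ 2 / 8 + P ^ 2 * B / 6" and "a3 = 1 / 6 * P * B"
  have half: "1 / 2 \<in> p_integers p" and third: "1 / 3 \<in> p_integers p"
    using p_integers_divide_of_nat[OF prime, of 1 2] p_integers_divide_of_nat[OF prime, of 1 3]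
      assms(2) by (simp_all add: p_integers_consts[OF prime])
  have PZ: "P \<in> p_integers p" by (simp add: P_def p_integers_of_nat[OF prime])
  have BZ: "B \<in> p_integers p" by (simp add: B_def bernoulli_p_integers[OF prime])
  note intros = p_integers_add[OF prime] p_integers_diff[OF prime] p_integers_mult[OF prime]
    p_integers_power[OF prime] p_integers_consts[OF prime] half third PZ BZ
  note pmult = p_ideal_prime_power_mult[OF prime, folded P_def]
  have "(\<Sum>k=0..p-1. of_nat k * ((pochhammer (1 / (P + 1)) k / fact k) ^ (p + 1)
      - binomial_weight p k * (1 + (d2 * harm_pow 2 k + d3 * harm_pow 3 k + d4 * harm_pow 4 k))))
    \<in> p_ideal p 6"
    unfolding P_def d2_def d3_def d4_def using assms(2)
    by (intro p_ideal_sum[OF prime] p_ideal_mult_left[OF prime] pochhammer_ratio_cong[OF prime]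
        p_integers_of_nat[OF prime]) auto
  \<comment> \<open>For the constant function all increments in the summation by parts are
    zero.\<close>
  moreover have "(\<Sum>k=0..p-1. of_nat k * binomial_weight p k) = 0"
    using sum_binomial_weight_mult[of p "\<lambda>_. 1"] assms(2) by simp
  ultimately have 1: "(\<Sum>k=0..p-1. of_nat k * (pochhammer (1 / (P + 1)) k / fact k) ^ (p + 1))
      - (d2 * A 2 + d3 * A 3 + d4 * A 4) \<in> p_ideal p 6"
    by (simp add: A_def right_diff_distrib distrib_left sum_subtractf sum.distrib sum_distrib_left mult_ac)
  have "d2 = P ^ 3 * (1 / 2 * (1 - P + P ^ 2))" "d3 = P ^ 4 * (2 * (1 / 3) - P)"
      "d4 = P ^ 5 * (3 * (1 / 2) * (1 / 2))"
    by (simp_all add: d2_def d3_def d4_def eval_nat_numeral field_simps)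
  then have d: "d2 \<in> p_ideal p 3" "d3 \<in> p_ideal p 4" "d4 \<in> p_ideal p 5"
    by (simp_all only: pmult intros)
  \<comment> \<open>The powers of \<open>p\<close> in \<open>d2\<close>, \<open>d3\<close>,
    \<open>d4\<close> complement the moduli \<open>p ^ 3\<close>, \<open>p ^ 2\<close>,
    \<open>p\<close> to \<open>p ^ 6\<close>.\<close>
  have A2: "d2 * (A 2 - a2) \<in> p_ideal p 6"
    using p_ideal_mult[OF prime d(1) weighted_harm_pow_2_cong[OF prime assms(2)]]
    by (simp add: A_def a2_def P_def B_def)
  have A3: "d3 * (A 3 + a3) \<in> p_ideal p 6"
    using p_ideal_mult[OF prime d(2) weighted_harm_pow_3_cong[OF prime assms(2)]]
    by (simp add: A_def a3_def P_def B_def)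
  have A4: "d4 * A 4 \<in> p_ideal p 6"
    using p_ideal_mult[OF prime d(3) weighted_harm_pow_4_p_ideal[OF prime assms(2)]]
    by (simp add: A_def)
  define R where "R = P ^ 3 / 4 - P ^ 4 / 8 + 3 / 16 * P ^ 5 - 1 / 36 * P ^ 5 * B"
  have R: "R \<in> p_integers p"
  proof -
    have "P ^ 3 * (1 / 2) ^ 2 - P ^ 4 * (1 / 2) ^ 3 + 3 * (1 / 2) ^ 4 * P ^ 5
        - (1 / 2) ^ 2 * (1 / 3) ^ 2 * P ^ 5 * B \<in> p_integers p"
      by (intro intros)
    then show ?thesis by (simp add: R_def power_one_over)
  qed
  \<comment> \<open>The exact excess of \<open>d2 * a2 - d3 * a3\<close> over \<open>R\<close>; the
    coefficient of \<open>P ^ 5 * B\<close> in \<open>R\<close> arises as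
    \<open>1/12 - 1/9 = -1/36\<close>.\<close>
  have "P ^ 6 * ((1 + P) * ((1 / 2) ^ 4 + (1 / 2) ^ 2 * (1 / 3) * B)) \<in> p_ideal p 6"
    by (intro pmult intros)
  also have "P ^ 6 * ((1 + P) * ((1 / 2) ^ 4 + (1 / 2) ^ 2 * (1 / 3) * B)) = d2 * a2 - d3 * a3 - R"
    by (simp add: d2_def d3_def a2_def a3_def R_def field_simps eval_nat_numeral)
  finally have "d2 * a2 - d3 * a3 - R \<in> p_ideal p 6" .
  from p_ideal_add[OF prime p_ideal_add[OF prime p_ideal_add[OF prime
        p_ideal_add[OF prime 1 A2] A3] A4] this]
  have "(\<Sum>k=0..p-1. of_nat k * (pochhammer (1 / (P + 1)) k / fact k) ^ (p + 1)) - R \<in> p_ideal p 6"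
    by (simp add: algebra_simps)
  with R show ?thesis
    by (simp add: p_cong_iff[OF prime] R_def P_def B_def power_divide add.commute)
qed

end
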